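(* Let $\mathcal{H}$ be a real Hilbert space, $A:\mathcal{H}\rightrightarrows\mathcal{H}$ a maximally monotone operator, $D:\mathcal{H}\to\mathcal{H}$ a monotone and $\eta^{-1}$-Lipschitz continuous operator with $\eta>0$, $B:\mathcal{H}\to\mathcal{H}$ a monotone and $\mu^{-1}$-Lipschitz continuous operator with $\mu>0$, and suppose that $C:=\operatorname{zer}B\neq\emptyset$. Let $(\lambda_n)_{n\ge 0}$ and $(\beta_n)_{n\ge 0}$ be sequences of positive real numbers. Let $x_0\in\mathcal{H}$, $y_{-1}=x_0$, and let $(x_n)_{n\ge 0}$, $(y_n)_{n\ge -1}$ be generated for all $n\ge 0$ by $$y_n=J_{\lambda_nA}\big[x_n-\lambda_nD(y_{n-1})-\lambda_n\beta_nB(y_{n-1})\big],$$ $$x_{n+1}=\lambda_n\beta_n\big[B(y_{n-1})-B(y_n)\big]+\lambda_n\big[D(y_{n-1})-D(y_n)\big]+y_n.$$ Assume that: (i) $A+N_C$ is maximally monotone and $\operatorname{zer}(A+D+N_C)\neq\emptyset$; (ii) for every $p\in\operatorname{ran}(N_C)$, $\sum_{n\ge 0}\lambda_n\beta_n\Big[\sup_{u\in C}\varphi_B\big(u,\tfrac{p}{\beta_n}\big)-\sigma_C\big(\tfrac{p}{\beta_n}\big)\Big]<+\infty$; (iii) $(\lambda_n)_{n\ge 0}\in\ell^2\setminus\ell^1$; that $\limsup_{n\to+\infty}\Big(\frac{\lambda_n\beta_n}{\mu}+\frac{\lambda_n}{\eta}\Big)<\frac12$, and that $A$ is $\gamma$-strongly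 monotone with $\gamma>0$. Then $(x_n)_{n\ge 0}$ converges strongly to the unique element of $\operatorname{zer}(A+D+N_C)$ as $n\to+\infty$.
   Context: For a set-valued operator $T:\mathcal{H}\rightrightarrows\mathcal{H}$: $\operatorname{Gr}T=\{(x,u):u\in Tx\}$, $\operatorname{zer}T=\{x:0\in Tx\}$, $\operatorname{ran}T=\{u:\exists x,\ u\in Tx\}$. $T$ is $\gamma$-strongly monotone if $\langle x-y,u-v\rangle\ge\gamma\|x-y\|^2$ for all $(x,u),(y,v)\in\operatorname{Gr}T$. The resolvent is $J_T=(\mathrm{Id}+T)^{-1}$, which is single-valued and everywhere defined when $T$ is maximally monotone. $N_C$ is the normal cone of the closed convex set $C$: $N_C(x)=\{u:\langle y-x,u\rangle\le 0\ \forall y\in C\}$ if $x\in C$, and $N_C(x)=\emptyset$ otherwise. The support function is $\sigma_C(u)=\sup_{y\in C}\langle y,u\rangle$. The Fitzpatrick function of a monotone operator $B$ is $\varphi_B(x,u)=\sup_{(y,v)\in\operatorname{Gr}B}\{\langle x,v\rangle+\langle y,u\rangle-\langle y,v\rangle\}\in\mathbb{R}\cup\{\pm\infty\}$. *)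

theory Defs
  imports "HOL-Analysis.Analysis" "HOL-Library.Set_Algebras"
begin

text \<open>A set-valued operator is a function into sets; a single-valued operator \<open>f\<close> is regarded as
  set-valued through its singleton values.\<close>

type_synonym 'a operator = "'a \<Rightarrow> 'a set"

definition single_valued_op :: "('a \<Rightarrow> 'a) \<Rightarrow> 'a operator" where
  "single_valued_op f = (\<lambda>x. {f x})"

definition op_graph :: "'a operator \<Rightarrow> ('a \<times> 'a) set" where
  "op_graph T = {(x, u). u \<in> T x}"

definition op_zeros :: "'a::zero operator \<Rightarrow> 'a set" where
  "op_zeros T = {x. 0 \<in> T x}"

definition op_range :: "'a operator \<Rightarrow> 'a set" where
  "op_range T = {u. \<exists>x. u \<in> T x}"

text \<open>The sum \<open>S x + T x\<close> below is the Minkowski sum of sets, empty if either set is empty.\<close>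

definition op_sum :: "'a::plus operator \<Rightarrow> 'a operator \<Rightarrow> 'a operator" where
  "op_sum S T = (\<lambda>x. S x + T x)"

definition op_scale :: "real \<Rightarrow> 'a::real_vector operator \<Rightarrow> 'a operator" where
  "op_scale c T = (\<lambda>x. (\<lambda>u. c *\<^sub>R u) ` T x)"

definition op_inverse :: "'a operator \<Rightarrow> 'a operator" where
  "op_inverse T = (\<lambda>u. {x. u \<in> T x})"

definition monotone_operator :: "'a::real_inner operator \<Rightarrow> bool" where
  "monotone_operator T \<longleftrightarrow>
     (\<forall>(x, u)\<in>op_graph T. \<forall>(y, v)\<in>op_graph T. 0 \<le> (x - y) \<bullet> (u - v))"

definition maximally_monotone :: "'a::real_inner operator \<Rightarrow> bool" where
  "maximally_monotone T \<longleftrightarrow> monotone_operator T \<and>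
     (\<forall>S. monotone_operator S \<and> op_graph T \<subseteq> op_graph S \<longrightarrow> op_graph S = op_graph T)"

definition strongly_monotone :: "real \<Rightarrow> 'a::real_inner operator \<Rightarrow> bool" where
  "strongly_monotone \<gamma> T \<longleftrightarrow>
     (\<forall>(x, u)\<in>op_graph T. \<forall>(y, v)\<in>op_graph T. \<gamma> * (norm (x - y))\<^sup>2 \<le> (x - y) \<bullet> (u - v))"

text \<open>The resolvent is kept set-valued: for monotone \<open>T\<close> each of its values has at most one element,
  and for maximally monotone \<open>T\<close> on a Hilbert space exactly one (Minty). In that case
  \<open>y \<in> resolvent T x\<close> says that \<open>y\<close> is the value of the resolvent at \<open>x\<close>.\<close>

definition resolvent :: "'a::real_inner operator \<Rightarrow> 'a operator" where
  "resolvent T = op_inverse (op_sum (single_valued_op id) T)"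

definition normal_cone :: "'a::real_inner set \<Rightarrow> 'a operator" where
  "normal_cone C x = (if x \<in> C then {u. \<forall>y\<in>C. (y - x) \<bullet> u \<le> 0} else {})"

definition support_function :: "'a::real_inner set \<Rightarrow> 'a \<Rightarrow> ereal" where
  "support_function C u = (SUP y\<in>C. ereal (y \<bullet> u))"

definition fitzpatrick :: "'a::real_inner operator \<Rightarrow> 'a \<Rightarrow> 'a \<Rightarrow> ereal" where
  "fitzpatrick B x u = (SUP (y, v)\<in>op_graph B. ereal (x \<bullet> v + y \<bullet> u - y \<bullet> v))"

end

theory Submission
  imports Defs
begin

text \<open>Write \<open>0 = v + D z + p\<close> with \<open>v \<in> A z\<close> and \<open>p \<in> N\<^sub>C z\<close>. Since
  \<open>(x\<^sub>n - x\<^sub>n\<^sub>+\<^sub>1) / \<lambda>\<^sub>n \<in> A y\<^sub>n + D y\<^sub>n + \<beta>\<^sub>n B y\<^sub>n\<close>, strong monotonicity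
  gives a descent estimate for \<open>\<parallel>x\<^sub>n - z\<parallel>\<^sup>2\<close> whose error is bounded by the gap in the Fitzpatrick
  condition. Once \<open>\<lambda>\<^sub>n \<beta>\<^sub>n / \<mu> + \<lambda>\<^sub>n / \<eta> \<le> L < 1/2\<close>, the sequence
  \<open>\<parallel>x\<^sub>n - z\<parallel>\<^sup>2 + L\<^sup>2 \<parallel>y\<^sub>n\<^sub>-\<^sub>1 - y\<^sub>n\<^sub>-\<^sub>2\<parallel>\<^sup>2\<close> is decreasing up to a summable error. Hence it
  converges, and both \<open>\<Sum> \<parallel>y\<^sub>n - y\<^sub>n\<^sub>-\<^sub>1\<parallel>\<^sup>2\<close> and \<open>\<Sum> \<lambda>\<^sub>n \<parallel>y\<^sub>n - z\<parallel>\<^sup>2\<close> are finite. So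
  \<open>\<parallel>x\<^sub>n - z\<parallel>\<close> and \<open>\<parallel>y\<^sub>n - z\<parallel>\<close> have a common limit, which must be \<open>0\<close> because
  \<open>\<Sum> \<lambda>\<^sub>n = \<infinity>\<close>.\<close>

text \<open>Subtracting from \<open>a\<close> the partial sums of \<open>e\<close> leaves a
  decreasing sequence \<open>c\<close>, bounded below because \<open>e\<close> is summable.
  Telescoping the drops of \<open>c\<close> then bounds the partial sums of
  \<open>b\<close>.\<close>

lemma quasi_decreasing_convergent:
  fixes a b e :: "nat \<Rightarrow> real"
  assumes a: "\<And>n. 0 \<le> a n" and b: "\<And>n. 0 \<le> b n" and e: "\<And>n. 0 \<le> e n"
    and sum_e: "summable e"
    and step: "\<And>n. a (Suc n) + b n \<le> a n + e n"
  shows "convergent a" "summable b"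
proof -
  define c where "c n = a n - (\<Sum>k<n. e k)" for n
  have sum_le: "(\<Sum>k<n. e k) \<le> suminf e" for n
    using sum_le_suminf[OF sum_e, of "{..<n}"] e by simp
  have c_step: "c (Suc n) + b n \<le> c n" for n
    using step[of n] by (simp add: c_def)
  have lower: "- suminf e \<le> c n" for n
    using sum_le[of n] a[of n] by (simp add: c_def)
  have dec: "decseq c"
    unfolding decseq_Suc_iff by (smt (verit) c_step b)
  obtain l where l: "c \<longlonglongrightarrow> l"
    using decseq_convergent[OF dec, of "- suminf e"] lower by blast
  have "(\<lambda>n. c n + (\<Sum>k<n. e k)) \<longlonglongrightarrow> l + suminf e"
    by (intro tendsto_add l summable_LIMSEQ sum_e)
  then show "convergent a"
    by (auto simp: c_def convergent_def)
  have c_sum: "c n + (\<Sum>k<n. b k) \<le> c 0" for n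
  proof (induction n)
    case (Suc n)
    then show ?case
      using c_step[of n] by simp
  qed simp
  have "(\<Sum>k<n. b k) \<le> c 0 + suminf e" for n
    using lower[of n] c_sum[of n] by linarith
  then show "summable b"
    by (intro summableI_nonneg_bounded[where x = "c 0 + suminf e"] b)
qed

text \<open>A normal vector at \<open>z\<close> is a linear functional whose maximum over
  \<open>C\<close> is attained at \<open>z\<close>, so the supremum is a real number.\<close>

lemma support_function_normal_cone:
  assumes "p \<in> normal_cone C z" "0 \<le> t"
  shows "support_function C (t *\<^sub>R p) = ereal (z \<bullet> (t *\<^sub>R p))"
proof -
  have le: "y \<bullet> p \<le> z \<bullet> p" if "y \<in> C" for y
    using assms(1) that by (auto simp: normal_cone_def inner_diff_left split: if_splits)
  show ?thesis
    unfolding support_function_def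
  proof (rule antisym)
    show "(SUP y\<in>C. ereal (y \<bullet> (t *\<^sub>R p))) \<le> ereal (z \<bullet> (t *\<^sub>R p))"
      by (rule SUP_least) (simp add: le mult_left_mono assms(2))
    show "ereal (z \<bullet> (t *\<^sub>R p)) \<le> (SUP y\<in>C. ereal (y \<bullet> (t *\<^sub>R p)))"
      using assms(1) by (intro SUP_upper) (auto simp: normal_cone_def split: if_splits)
  qed
qed

text \<open>Each supremum is bounded below by one admissible choice: \<open>u = z\<close> in the
  outer one, the pair \<open>(y, v)\<close> inside the Fitzpatrick function. The subtracted support
  function is finite, so extended-real subtraction is harmless.\<close>

lemma fitzpatrick_gap_ge:
  assumes "p \<in> normal_cone C z" "0 \<le> t" "v \<in> B y"
  shows "ereal (z \<bullet> v + y \<bullet> (t *\<^sub>R p) - y \<bullet> v - z \<bullet> (t *\<^sub>R p))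
    \<le> (SUP u\<in>C. fitzpatrick B u (t *\<^sub>R p)) - support_function C (t *\<^sub>R p)"
proof -
  have z: "z \<in> C"
    using assms(1) by (auto simp: normal_cone_def split: if_splits)
  have "ereal (z \<bullet> v + y \<bullet> (t *\<^sub>R p) - y \<bullet> v) \<le> fitzpatrick B z (t *\<^sub>R p)"
    unfolding fitzpatrick_def
    by (rule SUP_upper2[where i = "(y, v)"]) (use assms(3) in \<open>auto simp: op_graph_def\<close>)
  also have "\<dots> \<le> (SUP u\<in>C. fitzpatrick B u (t *\<^sub>R p))"
    by (rule SUP_upper[OF z])
  finally show ?thesis
    unfolding support_function_normal_cone[OF assms(1,2)]
    by (metis ereal_minus(1) ereal_minus_mono order_refl)
qed

lemma in_resolvent_scale_iff:
  "q \<in> resolvent (op_scale c T) w \<longleftrightarrow> (\<exists>a\<in>T q. w = q + c *\<^sub>R a)"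
  by (auto simp: resolvent_def op_inverse_def op_sum_def single_valued_op_def op_scale_def
      set_plus_def)

lemma strongly_monotoneD:
  assumes "strongly_monotone \<gamma> T" "u \<in> T x" "v \<in> T y"
  shows "\<gamma> * (norm (x - y))\<^sup>2 \<le> (x - y) \<bullet> (u - v)"
  using assms by (auto simp: strongly_monotone_def op_graph_def)

lemma monotone_single_valuedD:
  assumes "monotone_operator (single_valued_op f)"
  shows "0 \<le> (x - y) \<bullet> (f x - f y)"
  using assms by (auto simp: monotone_operator_def single_valued_op_def op_graph_def)

lemma op_sum_normal_cone_zeroE:
  assumes "z \<in> op_zeros (op_sum (op_sum A (single_valued_op D)) (normal_cone C))"
  obtains v p where "v \<in> A z" "p \<in> normal_cone C z" "v + D z + p = 0"
  using assms by (auto simp: op_zeros_def op_sum_def single_valued_op_def set_plus_def)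

text \<open>Subtract the two zero equations and take the inner product with \<open>w - z\<close>:
  the \<open>D\<close> and normal cone parts are nonnegative, so the strongly monotone part must
  vanish.\<close>

lemma zeros_unique:
  assumes strong: "strongly_monotone \<gamma> A" and \<gamma>: "0 < \<gamma>"
    and D: "monotone_operator (single_valued_op D)"
    and z: "z \<in> op_zeros (op_sum (op_sum A (single_valued_op D)) (normal_cone C))"
    and w: "w \<in> op_zeros (op_sum (op_sum A (single_valued_op D)) (normal_cone C))"
  shows "w = z"
proof -
  obtain v p where v: "v \<in> A z" "p \<in> normal_cone C z" "v + D z + p = 0"
    using z by (rule op_sum_normal_cone_zeroE)
  obtain v' p' where v': "v' \<in> A w" "p' \<in> normal_cone C w" "v' + D w + p' = 0"
    using w by (rule op_sum_normal_cone_zeroE)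
  have "(w - z) \<bullet> p \<le> 0" "(z - w) \<bullet> p' \<le> 0"
    using v(2) v'(2) by (auto simp: normal_cone_def split: if_splits)
  then have N: "0 \<le> (w - z) \<bullet> (p' - p)"
    by (simp add: inner_simps)
  have "(v' - v) + (D w - D z) + (p' - p) = 0"
    using arg_cong2[OF v'(3) v(3), of minus] by (simp add: algebra_simps)
  then have "(w - z) \<bullet> (v' - v) + (w - z) \<bullet> (D w - D z) + (w - z) \<bullet> (p' - p) = 0"
    by (metis inner_add_right inner_zero_right)
  then have "\<gamma> * (norm (w - z))\<^sup>2 \<le> 0"
    using N strongly_monotoneD[OF strong v'(1) v(1)] monotone_single_valuedD[OF D, of w z] by linarith
  then show ?thesis
    using \<gamma> by (simp add: mult_le_0_iff)
qed

lemma inner_extragradient_identity: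
  fixes y z x x' :: "'a::real_inner"
  shows "2 * ((y - z) \<bullet> (x - x'))
    = (norm (x' - y))\<^sup>2 - (norm (x - y))\<^sup>2 + (norm (x - z))\<^sup>2 - (norm (x' - z))\<^sup>2"
  by (simp add: power2_norm_eq_inner inner_simps inner_commute algebra_simps)

lemma norm_diff_square_le:
  fixes a b c :: "'a::real_inner"
  shows "(norm (a - c))\<^sup>2 \<le> 2 * (norm (a - b))\<^sup>2 + 2 * (norm (b - c))\<^sup>2"
proof -
  have "(norm (a - c))\<^sup>2 \<le> (norm (a - b) + norm (b - c))\<^sup>2"
    using norm_triangle_ineq[of "a - b" "b - c"] by (intro power_mono) auto
  also have "\<dots> \<le> 2 * (norm (a - b))\<^sup>2 + 2 * (norm (b - c))\<^sup>2"
    using zero_le_power2[of "norm (a - b) - norm (b - c)"] by (simp add: power2_eq_square algebra_simps)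
  finally show ?thesis .
qed

text \<open>Controls the correction that separates x_{n+1} from y_n; its factor is the quantity in
  the limsup hypothesis.\<close>

lemma forward_step_lipschitz:
  fixes B D :: "'a::real_normed_vector \<Rightarrow> 'a"
  assumes "(inverse \<mu>)-lipschitz_on UNIV B" "(inverse \<eta>)-lipschitz_on UNIV D"
    and "0 \<le> s" "0 \<le> t"
  shows "norm (s *\<^sub>R (B u - B w) + t *\<^sub>R (D u - D w)) \<le> (s / \<mu> + t / \<eta>) * norm (u - w)"
proof -
  have "norm (B u - B w) \<le> inverse \<mu> * norm (u - w)" "norm (D u - D w) \<le> inverse \<eta> * norm (u - w)"
    using lipschitz_onD[OF assms(1), of u w] lipschitz_onD[OF assms(2), of u w]
    by (auto simp: dist_norm)
  then have "s * norm (B u - B w) + t * norm (D u - D w)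
      \<le> s * (inverse \<mu> * norm (u - w)) + t * (inverse \<eta> * norm (u - w))"
    using assms(3,4) by (intro add_mono mult_left_mono)
  moreover have "norm (s *\<^sub>R (B u - B w) + t *\<^sub>R (D u - D w))
      \<le> s * norm (B u - B w) + t * norm (D u - D w)"
    using norm_triangle_ineq[of "s *\<^sub>R (B u - B w)" "t *\<^sub>R (D u - D w)"] assms(3,4) by simp
  ultimately show ?thesis
    by (simp add: field_class.field_divide_inverse algebra_simps)
qed

text \<open>The resolvent inclusion and the correction step combine to express \<open>x - x'\<close>
  as \<open>l\<close> times an element of \<open>A q + D q + b B q\<close>. Pairing it with
  \<open>q - z\<close> brings in strong monotonicity, and the four-point identity turns the pairing
  into squared distances.\<close>

lemma extragradient_descent:
  fixes A :: "'a::real_inner operator"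
  assumes strong: "strongly_monotone \<gamma> A" and D: "monotone_operator (single_valued_op D)"
    and v: "v \<in> A z" "v + D z + p = 0" and l: "0 < l"
    and q: "q \<in> resolvent (op_scale l A) (x - l *\<^sub>R D r - (l * b) *\<^sub>R B r)"
    and x': "x' = (l * b) *\<^sub>R (B r - B q) + l *\<^sub>R (D r - D q) + q"
  shows "(norm (x' - z))\<^sup>2 + (norm (x - q))\<^sup>2 + 2 * \<gamma> * (l * (norm (q - z))\<^sup>2)
    \<le> (norm (x - z))\<^sup>2 + (norm (x' - q))\<^sup>2 + 2 * (l * ((q - z) \<bullet> p - b * ((q - z) \<bullet> B q)))"
proof -
  obtain a where a: "a \<in> A q" "x - l *\<^sub>R D r - (l * b) *\<^sub>R B r = q + l *\<^sub>R a"
    using q by (auto simp: in_resolvent_scale_iff)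
  have "x - x' = (x - l *\<^sub>R D r - (l * b) *\<^sub>R B r) - q + l *\<^sub>R D q + (l * b) *\<^sub>R B q"
    unfolding x' by (simp add: algebra_simps)
  also have "\<dots> = l *\<^sub>R (a + D q + b *\<^sub>R B q)"
    unfolding a(2) by (simp add: algebra_simps)
  \<comment> \<open>The bracket \<open>v + D z + p\<close> is zero; inserting it pairs
    \<open>a\<close> with \<open>v\<close> and \<open>D q\<close> with \<open>D z\<close>.\<close>
  also have "a + D q + b *\<^sub>R B q = (a - v) + (D q - D z) - p + b *\<^sub>R B q + (v + D z + p)"
    by (simp add: algebra_simps)
  finally have "(q - z) \<bullet> (x - x') = l * ((q - z) \<bullet> (a - v) + (q - z) \<bullet> (D q - D z)
      - (q - z) \<bullet> p + b * ((q - z) \<bullet> B q))"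
    by (simp add: v(2) inner_add_right inner_diff_right)
  moreover have "\<gamma> * (norm (q - z))\<^sup>2 \<le> (q - z) \<bullet> (a - v) + (q - z) \<bullet> (D q - D z)"
    using strongly_monotoneD[OF strong a(1) v(1)] monotone_single_valuedD[OF D, of q z] by linarith
  then have "l * (\<gamma> * (norm (q - z))\<^sup>2) \<le> l * ((q - z) \<bullet> (a - v) + (q - z) \<bullet> (D q - D z))"
    using l by (intro mult_left_mono) auto
  ultimately show ?thesis
    using inner_extragradient_identity[of q z x x'] by (simp add: algebra_simps)
qed

theorem theorem6:
  fixes A :: "'a::{real_inner, complete_space} \<Rightarrow> 'a set"
    and D B :: "'a \<Rightarrow> 'a"
    and C :: "'a set"
    and \<eta> \<mu> \<gamma> :: real
    and lam \<beta> :: "nat \<Rightarrow> real"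
    and x :: "nat \<Rightarrow> 'a"
    and y :: "int \<Rightarrow> 'a"
  assumes A_max: "maximally_monotone A"
    and D_mono: "monotone_operator (single_valued_op D)"
    and eta_pos: "0 < \<eta>"
    and D_lip: "(inverse \<eta>)-lipschitz_on UNIV D"
    and B_mono: "monotone_operator (single_valued_op B)"
    and mu_pos: "0 < \<mu>"
    and B_lip: "(inverse \<mu>)-lipschitz_on UNIV B"
    and C_def: "C = op_zeros (single_valued_op B)"
    and C_nonempty: "C \<noteq> {}"
    and lam_pos: "\<And>n. 0 < lam n"
    and beta_pos: "\<And>n. 0 < \<beta> n"
    and y_init: "y (-1) = x 0"
    and y_step: "\<And>n. y (int n) \<in> resolvent (op_scale (lam n) A)
        (x n - lam n *\<^sub>R D (y (int n - 1)) - (lam n * \<beta> n) *\<^sub>R B (y (int n - 1)))"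
    and x_step: "\<And>n. x (Suc n) =
        (lam n * \<beta> n) *\<^sub>R (B (y (int n - 1)) - B (y (int n)))
        + lam n *\<^sub>R (D (y (int n - 1)) - D (y (int n))) + y (int n)"
    and sum_max: "maximally_monotone (op_sum A (normal_cone C))"
    and zeros_nonempty:
      "op_zeros (op_sum (op_sum A (single_valued_op D)) (normal_cone C)) \<noteq> {}"
    and fitzpatrick_sum: "\<And>p. p \<in> op_range (normal_cone C) \<Longrightarrow>
        (\<Sum>n. ereal (lam n * \<beta> n) *
          ((SUP u\<in>C. fitzpatrick (single_valued_op B) u (p /\<^sub>R \<beta> n))
            - support_function C (p /\<^sub>R \<beta> n))) < \<infinity>"
    and lam_l2: "summable (\<lambda>n. (lam n)\<^sup>2)"
    and lam_not_l1: "\<not> summable (\<lambda>n. \<bar>lam n\<bar>)"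
    and step_limsup: "limsup (\<lambda>n. ereal (lam n * \<beta> n / \<mu> + lam n / \<eta>)) < 1 / 2"
    and gamma_pos: "0 < \<gamma>"
    and A_strong: "strongly_monotone \<gamma> A"
  shows "\<exists>z. op_zeros (op_sum (op_sum A (single_valued_op D)) (normal_cone C)) = {z}
            \<and> x \<longlonglongrightarrow> z"
proof -
  obtain z where z: "z \<in> op_zeros (op_sum (op_sum A (single_valued_op D)) (normal_cone C))"
    using zeros_nonempty by blast
  have uniq: "op_zeros (op_sum (op_sum A (single_valued_op D)) (normal_cone C)) = {z}"
    using z zeros_unique[OF A_strong gamma_pos D_mono z] by blast
  obtain v p where v: "v \<in> A z" and p: "p \<in> normal_cone C z" and vp: "v + D z + p = 0"
    using z by (rule op_sum_normal_cone_zeroE)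
  have "z \<in> C"
    using p by (auto simp: normal_cone_def split: if_splits)
  then have Bz: "B z = 0"
    by (simp add: C_def op_zeros_def single_valued_op_def)

  \<comment> \<open>The shift makes y_{-1} equal to \<open>Y 0\<close>, so all indices are natural
    numbers: step \<open>n\<close> reads \<open>Y n\<close> and produces
    \<open>Y (Suc n)\<close>.\<close>
  define Y where "Y n = y (int n - 1)" for n
  have y_Y: "y (int n) = Y (Suc n)" for n
    by (simp add: Y_def)
  define gap where "gap n = (SUP u\<in>C. fitzpatrick (single_valued_op B) u (p /\<^sub>R \<beta> n))
      - support_function C (p /\<^sub>R \<beta> n)" for n
  \<comment> \<open>\<open>real_of_ereal\<close> would send an infinite term to 0. This does not
    happen here: the terms are nonnegative with finite sum, hence finite, as \<open>e_ereal\<close>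
    records.\<close>
  define e where "e n = real_of_ereal (ereal (lam n * \<beta> n) * gap n)" for n
  have gap_ge: "ereal (z \<bullet> B q + q \<bullet> (p /\<^sub>R \<beta> n) - q \<bullet> B q - z \<bullet> (p /\<^sub>R \<beta> n)) \<le> gap n" for n q
    unfolding gap_def using beta_pos[of n]
    by (intro fitzpatrick_gap_ge p) (auto simp: single_valued_op_def)
  \<comment> \<open>At \<open>q = z\<close> the lower bound is 0, since
    \<open>B z = 0\<close>.\<close>
  have gap_nonneg: "0 \<le> gap n" for n
    using gap_ge[of z n] by (simp add: Bz zero_ereal_def)
  have term_nonneg: "0 \<le> ereal (lam n * \<beta> n) * gap n" for n
    using gap_nonneg[of n] lam_pos[of n] beta_pos[of n] by (intro ereal_0_le_mult) auto
  have "p \<in> op_range (normal_cone C)"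
    using p by (auto simp: op_range_def)
  then have fin: "(\<Sum>n. ereal (lam n * \<beta> n) * gap n) \<noteq> \<infinity>"
    using fitzpatrick_sum[of p] by (simp add: gap_def)
  have e_sum: "summable e"
    unfolding e_def by (rule summable_real_of_ereal[OF term_nonneg fin])
  have e_nonneg: "0 \<le> e n" for n
    unfolding e_def by (rule real_of_ereal_pos[OF term_nonneg])
  have e_ereal: "ereal (e n) = ereal (lam n * \<beta> n) * gap n" for n
  proof -
    have "ereal (lam n * \<beta> n) * gap n \<noteq> \<infinity>"
      using suminf_PInfty[OF term_nonneg fin] .
    then show ?thesis
      unfolding e_def using term_nonneg[of n] by (intro ereal_real') auto
  qed
  have err: "lam n * ((q - z) \<bullet> p - \<beta> n * ((q - z) \<bullet> B q)) \<le> e n" for n q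
  proof -
    have "lam n * ((q - z) \<bullet> p - \<beta> n * ((q - z) \<bullet> B q))
        = lam n * \<beta> n * (z \<bullet> B q + q \<bullet> (p /\<^sub>R \<beta> n) - q \<bullet> B q - z \<bullet> (p /\<^sub>R \<beta> n))"
      using beta_pos[of n] by (simp add: inner_diff_left field_simps)
    also have "ereal \<dots> \<le> ereal (lam n * \<beta> n) * gap n"
      unfolding times_ereal.simps(1)[symmetric]
      using lam_pos[of n] beta_pos[of n] by (intro ereal_mult_left_mono gap_ge) auto
    finally show ?thesis
      by (simp flip: e_ereal)
  qed

  define d where "d n = (norm (Y (Suc n) - Y n))\<^sup>2" for n
  have d_nonneg: "0 \<le> d n" for n
    by (simp add: d_def)
  have descent: "(norm (x (Suc n) - z))\<^sup>2 + (norm (x n - Y (Suc n)))\<^sup>2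
        + 2 * \<gamma> * (lam n * (norm (Y (Suc n) - z))\<^sup>2)
      \<le> (norm (x n - z))\<^sup>2 + (norm (x (Suc n) - Y (Suc n)))\<^sup>2 + 2 * e n" for n
    using extragradient_descent[OF A_strong D_mono v vp lam_pos
        y_step[unfolded y_Y Y_def[symmetric]] x_step[unfolded y_Y Y_def[symmetric]], of n]
      err[of n "Y (Suc n)"] by linarith

  \<comment> \<open>A real \<open>L\<close> strictly below 1/2 gives
    \<open>L\<^sup>2 < 1 / 4\<close>, which makes the coefficient
    \<open>1 / 2 - 2 * L\<^sup>2\<close> in \<open>b\<close> positive.\<close>
  obtain L where L: "limsup (\<lambda>n. ereal (lam n * \<beta> n / \<mu> + lam n / \<eta>)) < ereal L" "ereal L < 1 / 2"
    using ereal_dense2[OF step_limsup] by blast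
  have "(1 / 2 :: ereal) = ereal (1 / 2)"
    by (simp add: one_ereal_def)
  with L(2) have L_half: "L < 1 / 2"
    by simp
  obtain N where N: "\<And>n. N \<le> n \<Longrightarrow> lam n * \<beta> n / \<mu> + lam n / \<eta> < L"
    using Limsup_lessD[OF L(1)] by (auto simp: eventually_sequentially)
  have step_nonneg: "0 < lam n * \<beta> n / \<mu> + lam n / \<eta>" for n
    using lam_pos beta_pos mu_pos eta_pos by (intro add_pos_pos divide_pos_pos mult_pos_pos)
  have L_pos: "0 < L"
    using N[of N] step_nonneg[of N] by simp
  have "L * L < 1 / 2 * (1 / 2)"
    using L_pos L_half by (intro mult_strict_mono) auto
  then have L_sq: "L\<^sup>2 < 1 / 4"
    by (simp add: power2_eq_square)
  have corr: "(norm (x (Suc n) - Y (Suc n)))\<^sup>2 \<le> L\<^sup>2 * d n" if "N \<le> n" for n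
  proof -
    have "norm (x (Suc n) - Y (Suc n)) \<le> (lam n * \<beta> n / \<mu> + lam n / \<eta>) * norm (Y n - Y (Suc n))"
      unfolding x_step[unfolded y_Y Y_def[symmetric]] add_diff_cancel_right'
      using lam_pos[of n] beta_pos[of n] by (intro forward_step_lipschitz B_lip D_lip) auto
    also have "\<dots> \<le> L * norm (Y (Suc n) - Y n)"
      using N[OF that] by (simp add: norm_minus_commute mult_right_mono)
    finally show ?thesis
      unfolding d_def power_mult_distrib[symmetric] by (intro power_mono) auto
  qed

  \<comment> \<open>Indices start at \<open>N\<close> so that \<open>corr\<close> applies at both
    \<open>n + N\<close> and its successor.\<close>
  define a where "a n = (norm (x (Suc (n + N)) - z))\<^sup>2 + L\<^sup>2 * d (n + N)" for n
  define b where "b n = (1 / 2 - 2 * L\<^sup>2) * d (Suc (n + N))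
      + 2 * \<gamma> * (lam (Suc (n + N)) * (norm (Y (Suc (Suc (n + N))) - z))\<^sup>2)" for n
  have b1: "0 \<le> (1 / 2 - 2 * L\<^sup>2) * d n" for n
    using L_sq d_nonneg by (intro mult_nonneg_nonneg) auto
  have b2: "0 \<le> 2 * \<gamma> * (lam n * (norm (Y (Suc n) - z))\<^sup>2)" for n
    using gamma_pos lam_pos[of n] by auto
  \<comment> \<open>With m = n + N, the parallelogram-type bound gives ||x_{m+1} - Y_{m+2}||^2 >=
    d_{m+1}/2 - L^2 d_m. Of the two copies of L^2 d_{m+1} taken from d_{m+1}/2, one pays for the
    correction at step m+1 and the other enters \<open>a (Suc n)\<close>.\<close>
  have step: "a (Suc n) + b n \<le> a n + 2 * e (Suc (n + N))" for n
  proof -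
    let ?m = "n + N"
    have "d (Suc ?m) \<le> 2 * (norm (x (Suc ?m) - Y (Suc (Suc ?m))))\<^sup>2
        + 2 * (norm (x (Suc ?m) - Y (Suc ?m)))\<^sup>2"
      unfolding d_def using norm_diff_square_le[of "Y (Suc (Suc ?m))" "Y (Suc ?m)" "x (Suc ?m)"]
      by (simp add: norm_minus_commute)
    then show ?thesis
      using descent[of "Suc ?m"] corr[of ?m] corr[of "Suc ?m"]
      unfolding a_def b_def by (simp add: algebra_simps)
  qed
  have a_conv: "convergent a" and b_sum: "summable b"
  proof -
    have *: "0 \<le> a n" "0 \<le> b n" "0 \<le> 2 * e (Suc (n + N))" for n
      using b1[of "Suc (n + N)"] b2[of "Suc (n + N)"] d_nonneg e_nonneg
      by (auto simp: a_def b_def)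
    have "summable (\<lambda>n. 2 * e (Suc (n + N)))"
      using summable_ignore_initial_segment[OF e_sum, of "Suc N"] by (intro summable_mult) simp
    then show "convergent a" "summable b"
      using quasi_decreasing_convergent[of a b "\<lambda>n. 2 * e (Suc (n + N))"] * step by blast+
  qed
  \<comment> \<open>\<open>b\<close> is a sum of two nonnegative terms, so it dominates each of them
    separately.\<close>
  have "summable (\<lambda>n. (1 / 2 - 2 * L\<^sup>2) * d (n + Suc N))"
    by (rule summable_comparison_test'[OF b_sum, of 0]) (use b1 b2 in \<open>simp add: b_def\<close>)
  then have "summable (\<lambda>n. d (n + Suc N))"
    using L_sq by (simp add: summable_cmult_iff)
  then have d_lim: "d \<longlonglongrightarrow> 0"
    unfolding summable_iff_shift by (rule summable_LIMSEQ_zero)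
  have "summable (\<lambda>n. 2 * \<gamma> * (lam (n + Suc N) * (norm (Y (Suc (n + Suc N)) - z))\<^sup>2))"
    by (rule summable_comparison_test'[OF b_sum, of 0]) (use b1 b2 in \<open>simp add: b_def\<close>)
  then have "summable (\<lambda>n. lam (n + Suc N) * (norm (Y (Suc (n + Suc N)) - z))\<^sup>2)"
    using gamma_pos by (simp add: summable_cmult_iff)
  then have lamY_sum: "summable (\<lambda>n. lam n * (norm (Y (Suc n) - z))\<^sup>2)"
    by (subst (asm) summable_iff_shift)

  obtain l where "a \<longlonglongrightarrow> l"
    using a_conv by (auto simp: convergent_def)
  then have "(\<lambda>n. a n - L\<^sup>2 * d (n + N)) \<longlonglongrightarrow> l - L\<^sup>2 * 0"
    by (intro tendsto_diff tendsto_mult tendsto_const LIMSEQ_ignore_initial_segment d_lim)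
  then have "(\<lambda>n. (norm (x (n + Suc N) - z))\<^sup>2) \<longlonglongrightarrow> l"
    by (simp add: a_def)
  then have "(\<lambda>n. (norm (x n - z))\<^sup>2) \<longlonglongrightarrow> l"
    by (rule LIMSEQ_offset)
  then have "(\<lambda>n. sqrt ((norm (x n - z))\<^sup>2)) \<longlonglongrightarrow> sqrt l"
    by (rule tendsto_real_sqrt)
  then have x_lim: "(\<lambda>n. norm (x n - z)) \<longlonglongrightarrow> sqrt l"
    by simp
  have "(\<lambda>n. (norm (x (Suc n) - Y (Suc n)))\<^sup>2) \<longlonglongrightarrow> 0"
  proof (rule Lim_null_comparison)
    show "\<forall>\<^sub>F n in sequentially. norm ((norm (x (Suc n) - Y (Suc n)))\<^sup>2) \<le> L\<^sup>2 * d n"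
      using corr by (auto simp: eventually_sequentially)
    show "(\<lambda>n. L\<^sup>2 * d n) \<longlonglongrightarrow> 0"
      using tendsto_mult[OF tendsto_const d_lim, of "L\<^sup>2"] by simp
  qed
  then have "(\<lambda>n. norm (x (Suc n) - Y (Suc n))) \<longlonglongrightarrow> 0"
    using tendsto_real_sqrt by fastforce
  \<comment> \<open>Reverse triangle inequality: the distances of x_{n+1} and y_n to
    \<open>z\<close> differ by at most the vanishing correction.\<close>
  then have diff0: "(\<lambda>n. norm (Y (Suc n) - z) - norm (x (Suc n) - z)) \<longlonglongrightarrow> 0"
  proof (rule Lim_null_comparison[rotated])
    have "norm (norm (Y (Suc n) - z) - norm (x (Suc n) - z)) \<le> norm (x (Suc n) - Y (Suc n))" for n
      using norm_triangle_ineq3[of "Y (Suc n) - z" "x (Suc n) - z"] by (simp add: norm_minus_commute)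
    then show "\<forall>\<^sub>F n in sequentially. norm (norm (Y (Suc n) - z) - norm (x (Suc n) - z))
        \<le> norm (x (Suc n) - Y (Suc n))"
      by simp
  qed
  have Y_lim: "(\<lambda>n. norm (Y (Suc n) - z)) \<longlonglongrightarrow> sqrt l"
    using tendsto_add[OF diff0 LIMSEQ_Suc[OF x_lim]] by simp
  have "sqrt l = 0"
  proof (rule ccontr)
    assume "sqrt l \<noteq> 0"
    \<comment> \<open>\<open>sqrt\<close> is negative on negative reals, so the sign is read off
      from the limit of norms instead.\<close>
    moreover have "0 \<le> sqrt l"
      using x_lim by (rule LIMSEQ_le_const) auto
    ultimately have s: "0 < sqrt l / 2" "sqrt l / 2 < sqrt l"
      by auto
    obtain M where M: "\<And>n. M \<le> n \<Longrightarrow> sqrt l / 2 < norm (Y (Suc n) - z)"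
      using order_tendstoD(1)[OF Y_lim s(2)] by (auto simp: eventually_sequentially)
    \<comment> \<open>Eventually the distance of y_n to \<open>z\<close> exceeds half its limit, so
      a positive multiple of \<open>lam\<close> is dominated by the summable weighted
      squares.\<close>
    have "summable (\<lambda>n. (sqrt l / 2)\<^sup>2 * lam n)"
    proof (rule summable_comparison_test'[OF lamY_sum, of M])
      fix n assume "M \<le> n"
      then have "(sqrt l / 2)\<^sup>2 \<le> (norm (Y (Suc n) - z))\<^sup>2"
        using M[of n] s(1) by (intro power_mono) auto
      then show "norm ((sqrt l / 2)\<^sup>2 * lam n) \<le> lam n * (norm (Y (Suc n) - z))\<^sup>2"
        using lam_pos[of n] by (simp add: abs_mult mult.commute)
    qed
    then have "summable lam"
      using s(1) by (simp add: summable_cmult_iff)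
    then show False
      using lam_not_l1 lam_pos by (simp add: abs_of_pos)
  qed
  with x_lim have "x \<longlonglongrightarrow> z"
    by (metis LIM_zero_cancel tendsto_norm_zero_iff)
  with uniq show ?thesis
    by blast
qed

end
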